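(* For every $n\geq 1$, $$B_{2n+2} = \{0\}\cup\{M_{2n+2}\}\cup\{0p_{2(n-i)+1}0 : i\in\{0,1,\ldots,n-1\}\},$$ $$B_{2n+3} = \{1\}\cup\{M_{2n+3}\}\cup\{1p_{2(n-i)+2}1 : i\in\{0,1,\ldots,n-1\}\},$$ and $B_3=\{1,11\}$.
   Context: Finite Fibonacci words: $f_1=1$, $f_2=0$, $f_{n+2}=f_{n+1}f_n$. For $n\geq 3$, $p_n$ is $f_n$ with its last two letters deleted ($p_3=\epsilon$, $p_4=0$, $p_5=010$, ...). The minimal forbidden factors of the infinite Fibonacci word are $M_{2n+1}=1p_{2n+1}1$ and $M_{2n+2}=0p_{2n+2}0$ for $n\geq 1$ (so $M_3=11$). A word $b$ is a border of $w$ if $w=xb=by$ for some words $x,y$. For $n\geq 3$, $B_n$ is the set of all nonempty borders of $M_n$. *)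

theory Defs
  imports Main
begin

(* Words are lists over nat; only the letters 0 and 1 occur. The sequence is indexed
   from 1, and the value at index 0 is a dummy. *)
fun fib_word :: "nat \<Rightarrow> nat list" where
  "fib_word 0 = []"
| "fib_word (Suc 0) = [1]"
| "fib_word (Suc (Suc 0)) = [0]"
| "fib_word (Suc (Suc (Suc n))) = fib_word (Suc (Suc n)) @ fib_word (Suc n)"

(* Intended for n >= 3, where fib_word n has at least two letters. *)
definition p :: "nat \<Rightarrow> nat list" where
  "p n = take (length (fib_word n) - 2) (fib_word n)"

(* For n >= 3 these are the minimal forbidden factors of the infinite Fibonacci word. *)
definition M :: "nat \<Rightarrow> nat list" where
  "M n = (if odd n then [1] @ p n @ [1] else [0] @ p n @ [0])"

(* The two occurrences may overlap, and a word is a border of itself. *)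
definition border :: "'a list \<Rightarrow> 'a list \<Rightarrow> bool" where
  "border b w \<longleftrightarrow> (\<exists>x y. w = x @ b \<and> w = b @ y)"

definition B :: "nat \<Rightarrow> nat list set" where
  "B n = {b. b \<noteq> [] \<and> border b (M n)}"

end

theory Submission
  imports Defs
begin

text \<open>The Fibonacci morphism \<open>0 \<mapsto> 01\<close>, \<open>1 \<mapsto> 0\<close> satisfies \<open>p (n + 1) = \<phi> (p n) 0\<close>. Every block
  \<open>\<phi> a\<close> starts with \<open>0\<close> and contains no other \<open>0\<close>, so a nonempty border of \<open>p (n + 1)\<close>, which
  starts and ends with \<open>0\<close>, is \<open>\<phi> w 0\<close> for a border \<open>w\<close> of \<open>p n\<close>. Hence the borders of \<open>p n\<close> are
  \<open>p 3, \<dots>, p n\<close>. A border of \<open>M n = c p n c\<close> other than \<open>c\<close> and \<open>M n\<close> has the form \<open>c v c\<close> with \<open>v c\<close>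
  a prefix and \<open>c v\<close> a suffix of \<open>p n\<close>, so \<open>v = p k\<close> with \<open>k < n\<close>. In \<open>p n\<close> the prefix \<open>p k\<close> is
  followed by \<open>0\<close> if \<open>k\<close> is odd and by \<open>1\<close> otherwise, so \<open>k\<close> and \<open>n\<close> have opposite parity.\<close>

definition fib_morph :: "nat list \<Rightarrow> nat list" where
  "fib_morph w = concat (map (\<lambda>a. if a = 0 then [0, 1] else [0]) w)"

lemma fib_morph_simps [simp]:
  "fib_morph [] = []"
  "fib_morph (a # w) = (if a = 0 then [0, 1] else [0]) @ fib_morph w"
  "fib_morph (v @ w) = fib_morph v @ fib_morph w"
  by (simp_all add: fib_morph_def)

lemma fib_morph_snoc_starts_0: "\<exists>z. fib_morph w @ [0] = 0 # z"
  by (cases w) auto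

lemma set_fib_morph: "set (fib_morph w) \<subseteq> {0, 1}"
  by (induction w) auto

lemma fib_word_Suc: "n \<ge> 1 \<Longrightarrow> fib_word (Suc n) = fib_morph (fib_word n)"
proof (induction n rule: fib_word.induct)
  case (4 n)
  have "fib_word (Suc (Suc (Suc (Suc n)))) = fib_word (Suc (Suc (Suc n))) @ fib_word (Suc (Suc n))"
    by (rule fib_word.simps)
  also have "\<dots> = fib_morph (fib_word (Suc (Suc n)) @ fib_word (Suc n))"
    using 4 by (simp del: fib_word.simps)
  finally show ?case by simp
qed simp_all

lemma p_eqI: "fib_word n = w @ [a, b] \<Longrightarrow> p n = w"
  by (simp add: p_def)

lemma p_3 [simp]: "p 3 = []"
  by (simp add: p_def numeral_3_eq_3)

text \<open>The final letters 01 and 10 have images 010 and 001. Both are a 0 followed by the two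
  letters in swapped order, and this 0 joins the prefix.\<close>

lemma fib_morph_fib_word:
  assumes "n \<ge> 1" "fib_word n = p n @ [Suc n mod 2, n mod 2]"
  shows "fib_word (Suc n) = (fib_morph (p n) @ [0]) @ [n mod 2, Suc n mod 2]"
proof -
  have "fib_word (Suc n) = fib_morph (p n @ [Suc n mod 2, n mod 2])"
    using assms by (simp only: fib_word_Suc)
  then show ?thesis by (cases "even n") (simp_all add: mod2_eq_if)
qed

lemma fib_word_eq_p: "n \<ge> 3 \<Longrightarrow> fib_word n = p n @ [Suc n mod 2, n mod 2]"
proof (induction n rule: dec_induct)
  case base
  show ?case by (simp add: numeral_3_eq_3 p_def)
next
  case (step n)
  then have *: "fib_word (Suc n) = (fib_morph (p n) @ [0]) @ [n mod 2, Suc n mod 2]"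
    by (intro fib_morph_fib_word) auto
  have "Suc (Suc n) mod 2 = n mod 2" by simp
  with * p_eqI[OF *] show ?case by (simp only:)
qed

lemma p_Suc: "n \<ge> 3 \<Longrightarrow> p (Suc n) = fib_morph (p n) @ [0]"
  by (rule p_eqI, rule fib_morph_fib_word) (simp, rule fib_word_eq_p)

lemma set_p: "n \<ge> 3 \<Longrightarrow> set (p n) \<subseteq> {0, 1}"
  by (induction n rule: dec_induct) (use set_fib_morph in \<open>auto simp: p_Suc\<close>)

text \<open>The first block is 01 exactly when a 1 follows the initial 0, because no image starts
  with 1. The alphabet must be restricted, since every nonzero letter has image 0.\<close>

lemma fib_morph_inj:
  "\<lbrakk>fib_morph v = fib_morph w; set v \<subseteq> {0, 1}; set w \<subseteq> {0, 1}\<rbrakk> \<Longrightarrow> v = w"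
proof (induction v arbitrary: w)
  case Nil
  then show ?case by (cases w) (auto split: if_splits)
next
  case (Cons a v)
  have no_1: "fib_morph u \<noteq> 1 # z" for u z by (cases u) auto
  from Cons.prems obtain b w' where w: "w = b # w'" by (cases w) (auto split: if_splits)
  have "a = b" using Cons.prems no_1 no_1[symmetric] by (auto simp: w split: if_splits)
  then show ?case using Cons by (auto simp: w)
qed

text \<open>A factorisation of \<open>fib_morph s 0\<close> in front of a \<open>0\<close> respects the blocks.\<close>

lemma fib_morph_split:
  assumes "x @ 0 # z = fib_morph s @ [0]"
  shows "\<exists>v w. s = v @ w \<and> x = fib_morph v \<and> 0 # z = fib_morph w @ [0]"
  using assms
proof (induction s arbitrary: x)
  case Nil
  then show ?case by (cases x) auto
next
  case (Cons a s)
  show ?case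
  proof (cases x)
    case Nil
    with Cons.prems show ?thesis by (intro exI[of _ "[]"] exI[of _ "a # s"]) simp
  next
    case x: (Cons b y)
    obtain y' where y': "x = fib_morph [a] @ y'" "y' @ 0 # z = fib_morph s @ [0]"
      using Cons.prems by (cases y) (auto simp: x split: if_splits)
    from Cons.IH[OF y'(2)] obtain v w
      where "s = v @ w" "y' = fib_morph v" "0 # z = fib_morph w @ [0]" by blast
    with y'(1) show ?thesis by (intro exI[of _ "a # v"] exI[of _ w]) simp
  qed
qed

lemma border_p:
  assumes "n \<ge> 3" "border u (p n)"
  shows "\<exists>k\<in>{3..n}. u = p k"
  using assms
proof (induction n arbitrary: u rule: dec_induct)
  case base
  then show ?case by (simp add: border_def)
next
  case (step n)
  show ?case
  proof (cases u rule: rev_cases)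
    case Nil
    with step.hyps show ?thesis by (intro bexI[of _ 3]) auto
  next
    case (snoc u' a)
    from step.prems obtain x y
      where xu: "x @ u = fib_morph (p n) @ [0]" and uy: "u @ y = fib_morph (p n) @ [0]"
      using step.hyps by (auto simp: border_def p_Suc)
    have a: "a = 0" using xu by (simp add: snoc flip: append_assoc)
    obtain z where z: "u = 0 # z"
      using uy fib_morph_snoc_starts_0[of "p n"] by (cases u') (auto simp: snoc a)
    \<comment> \<open>The prefix \<open>u\<close> is cut before its last 0 and the suffix
      \<open>u\<close> before its first 0. Both cuts lie on block boundaries, so each yields a
      preimage of \<open>u'\<close>.\<close>
    have "u' @ 0 # y = fib_morph (p n) @ [0]" using uy by (simp add: snoc a)
    then obtain v r where v: "p n = v @ r" "u' = fib_morph v"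
      using fib_morph_split by blast
    obtain s w where w: "p n = s @ w" "u = fib_morph w @ [0]"
      using fib_morph_split xu z by metis
    have "set v \<subseteq> {0, 1}" "set w \<subseteq> {0, 1}"
      using set_p[OF step.hyps(1)] v(1) w(1) by (metis le_sup_iff set_append)+
    moreover have "fib_morph v = fib_morph w" using v(2) w(2) by (simp add: snoc)
    ultimately have "v = w" using fib_morph_inj by blast
    with v(1) w(1) have "border w (p n)" unfolding border_def by metis
    from step.IH[OF this] obtain k where "k \<in> {3..n}" "w = p k" by blast
    with w(2) show ?thesis by (intro bexI[of _ "Suc k"]) (auto simp: p_Suc)
  qed
qed

text \<open>Induction on \<open>k\<close>: the morphism takes an occurrence of \<open>p k\<close>
  next to a letter \<open>l\<close> to one of \<open>p (Suc k)\<close> next to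
  \<open>1 - l\<close>.\<close>

lemma p_less_factors:
  assumes "3 \<le> k" "k < n"
  shows "(\<exists>y. p n = p k @ [Suc k mod 2] @ y) \<and> (\<exists>x. p n = x @ [Suc k mod 2] @ p k)"
  using assms
proof (induction k arbitrary: n rule: dec_induct)
  case base
  then obtain m where "n = Suc m" "m \<ge> 3" by (cases n) auto
  then show ?case using fib_morph_snoc_starts_0[of "p m"] by (auto simp: p_Suc)
next
  case (step k)
  then obtain m where m: "n = Suc m" "k < m" by (cases n) auto
  let ?l = "Suc k mod 2"
  from step.IH[OF m(2)] obtain x y
    where y: "p m = p k @ [?l] @ y" and x: "p m = x @ [?l] @ p k" by blast
  from fib_morph_snoc_starts_0 obtain z where z: "fib_morph y @ [0] = 0 # z" by blast
  have "p n = fib_morph (p m) @ [0]" using m step.hyps by (simp add: p_Suc)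
  \<comment> \<open>The first 0 completes \<open>p (Suc k)\<close>. The next letter is the 1 of the
    block 01 if \<open>?l\<close> is 0, and otherwise the 0 that starts
    \<open>fib_morph y @ [0]\<close>.\<close>
  moreover have "\<exists>y'. fib_morph [?l] @ fib_morph y @ [0] = [0, Suc (Suc k) mod 2] @ y'"
    using z by (cases "even k") (auto simp: mod2_eq_if)
  then have "\<exists>y'. fib_morph (p m) @ [0] = p (Suc k) @ [Suc (Suc k) mod 2] @ y'"
    using step.hyps by (simp add: y p_Suc)
  \<comment> \<open>On the left, the neighbour of \<open>p (Suc k)\<close> is the last letter of the
    block of \<open>?l\<close>.\<close>
  moreover have "\<exists>x'. fib_morph [?l] = x' @ [Suc (Suc k) mod 2]"
    by (cases "even k") (auto simp: mod2_eq_if)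
  then obtain x' where x': "fib_morph [?l] = x' @ [Suc (Suc k) mod 2]" by blast
  have "fib_morph (p m) = fib_morph x @ fib_morph [?l] @ fib_morph (p k)"
    by (simp only: x fib_morph_simps(3))
  then have "fib_morph (p m) @ [0] = (fib_morph x @ x') @ [Suc (Suc k) mod 2] @ p (Suc k)"
    using step.hyps unfolding x' by (simp add: p_Suc)
  then have "\<exists>x'. fib_morph (p m) @ [0] = x' @ [Suc (Suc k) mod 2] @ p (Suc k)" by blast
  ultimately show ?case by simp
qed

lemma M_eq: "M n = [n mod 2] @ p n @ [n mod 2]"
  by (simp add: M_def mod2_eq_if)

lemma border_bracket_iff:
  "b \<noteq> [] \<and> border b ([c] @ w @ [c]) \<longleftrightarrow>
    b = [c] \<or> b = [c] @ w @ [c] \<or>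
    (\<exists>v. b = [c] @ v @ [c] \<and> (\<exists>y. w = v @ [c] @ y) \<and> (\<exists>x. w = x @ [c] @ v))"
  (is "?L \<longleftrightarrow> ?R")
proof
  assume ?L
  then obtain x y where x: "[c] @ w @ [c] = x @ b" and y: "[c] @ w @ [c] = b @ y"
    and "b \<noteq> []" unfolding border_def by blast
  obtain b' where b': "b = c # b'" using y \<open>b \<noteq> []\<close> by (cases b) auto
  show ?R
  proof (cases b' rule: rev_cases)
    case Nil
    then show ?thesis by (simp add: b')
  next
    case (snoc v d)
    have "(c # w) @ [c] = (x @ c # v) @ [d]" using x by (auto simp: b' snoc)
    then have d: "d = c" and xv: "c # w = x @ c # v" unfolding append1_eq_conv by blast+
    show ?thesis
    proof (cases x)
      case Nil
      then show ?thesis using xv by (simp add: b' snoc d)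
    next
      case (Cons e x')
      \<comment> \<open>\<open>x\<close> and \<open>y\<close> have equal length, so neither is
        empty.\<close>
      have "y \<noteq> []" using arg_cong[OF x, of length] arg_cong[OF y, of length] Cons by auto
      then obtain y' f where "y = y' @ [f]" by (cases y rule: rev_cases) auto
      then have "w @ [c] = (v @ [c] @ y') @ [f]" using y by (simp add: b' snoc d)
      then have "w = v @ [c] @ y'" by simp
      then show ?thesis using xv Cons by (auto simp: b' snoc d)
    qed
  qed
next
  assume ?R
  then show ?L unfolding border_def
  proof (elim disjE exE conjE)
    assume "b = [c]"
    then show "b \<noteq> [] \<and> (\<exists>x y. [c] @ w @ [c] = x @ b \<and> [c] @ w @ [c] = b @ y)"
      by (auto intro!: exI[of _ "c # w"])
  next
    fix v x y assume b: "b = [c] @ v @ [c]" and y: "w = v @ [c] @ y" and x: "w = x @ [c] @ v"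
    have "[c] @ w @ [c] = (c # x) @ b" unfolding x b by simp
    moreover have "[c] @ w @ [c] = b @ (y @ [c])" unfolding y b by simp
    ultimately show "b \<noteq> [] \<and> (\<exists>x y. [c] @ w @ [c] = x @ b \<and> [c] @ w @ [c] = b @ y)"
      using b by blast
  qed auto
qed

lemma B_eq:
  assumes "n \<ge> 3"
  shows "B n = {[n mod 2]} \<union> {M n} \<union>
    {[n mod 2] @ p k @ [n mod 2] | k. 3 \<le> k \<and> k < n \<and> odd k \<noteq> odd n}"
proof -
  let ?c = "n mod 2"
  have "(\<exists>y. p n = v @ [?c] @ y) \<and> (\<exists>x. p n = x @ [?c] @ v) \<longleftrightarrow>
      (\<exists>k. v = p k \<and> 3 \<le> k \<and> k < n \<and> odd k \<noteq> odd n)" (is "?L \<longleftrightarrow> ?R") for v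
  proof
    assume ?L
    then obtain x y where y: "p n = v @ [?c] @ y" and x: "p n = x @ [?c] @ v" by blast
    have "border v (p n)" unfolding border_def
      by (intro exI[of _ "x @ [?c]"] exI[of _ "[?c] @ y"]) (use x y in auto)
    with assms obtain k where k: "3 \<le> k" "k \<le> n" "v = p k" using border_p by fastforce
    have "k \<noteq> n" using y k(3) by auto
    with k have kn: "k < n" by simp
    \<comment> \<open>Two descriptions of the letter after the prefix \<open>p k\<close> of
      \<open>p n\<close> are compared.\<close>
    from p_less_factors[OF k(1) this] y k(3) have "Suc k mod 2 = ?c" by auto
    then have "odd k \<noteq> odd n" by presburger
    with k kn show ?R by blast
  next
    assume ?R
    then obtain k where k: "v = p k" "3 \<le> k" "k < n" "odd k \<noteq> odd n" by blast
    then have "Suc k mod 2 = ?c" by presburger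
    with p_less_factors[OF k(2,3)] k(1) show ?L by simp
  qed
  then have "B n = {b. b = [?c] \<or> b = M n \<or> (\<exists>v. b = [?c] @ v @ [?c] \<and>
      (\<exists>k. v = p k \<and> 3 \<le> k \<and> k < n \<and> odd k \<noteq> odd n))}"
    by (simp only: B_def M_eq border_bracket_iff)
  then show ?thesis by blast
qed

theorem theorem3:
  shows "(\<forall>n\<ge>1.
      B (2 * n + 2) = {[0]} \<union> {M (2 * n + 2)} \<union>
        {[0] @ p (2 * (n - i) + 1) @ [0] | i. i \<in> {0..n - 1}} \<and>
      B (2 * n + 3) = {[1]} \<union> {M (2 * n + 3)} \<union>
        {[1] @ p (2 * (n - i) + 2) @ [1] | i. i \<in> {0..n - 1}}) \<and>
    B 3 = {[1], [1, 1]}"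
proof (intro conjI allI impI)
  fix n :: nat assume n: "1 \<le> n"
  have "(3 \<le> k \<and> k < 2 * n + 2 \<and> odd k \<noteq> odd (2 * n + 2)) \<longleftrightarrow>
      (\<exists>i\<in>{0..n - 1}. k = 2 * (n - i) + 1)" for k
  proof
    assume *: "3 \<le> k \<and> k < 2 * n + 2 \<and> odd k \<noteq> odd (2 * n + 2)"
    then obtain j where "k = 2 * j + 1" by (auto elim: oddE)
    with * show "\<exists>i\<in>{0..n - 1}. k = 2 * (n - i) + 1" by (intro bexI[of _ "n - j"]) auto
  qed (use n in auto)
  moreover have "(2 * n + 2) mod 2 = 0" "3 \<le> 2 * n + 2" using n by auto
  ultimately show "B (2 * n + 2) = {[0]} \<union> {M (2 * n + 2)} \<union>
      {[0] @ p (2 * (n - i) + 1) @ [0] | i. i \<in> {0..n - 1}}"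
    by (simp only: B_eq) blast
  have "(3 \<le> k \<and> k < 2 * n + 3 \<and> odd k \<noteq> odd (2 * n + 3)) \<longleftrightarrow>
      (\<exists>i\<in>{0..n - 1}. k = 2 * (n - i) + 2)" for k
  proof
    assume *: "3 \<le> k \<and> k < 2 * n + 3 \<and> odd k \<noteq> odd (2 * n + 3)"
    then obtain j where "k = 2 * j" by (auto elim: evenE)
    \<comment> \<open>\<open>2 * j = 2 * (n - i) + 2\<close> means \<open>i = n + 1 - j\<close>, and
      \<open>3 \<le> k\<close> forces \<open>2 \<le> j\<close>, so
      \<open>i \<le> n - 1\<close>.\<close>
    with * show "\<exists>i\<in>{0..n - 1}. k = 2 * (n - i) + 2" by (intro bexI[of _ "n + 1 - j"]) auto
  qed (use n in auto)
  moreover have "(2 * n + 3) mod 2 = 1" "3 \<le> 2 * n + 3" by presburger+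
  ultimately show "B (2 * n + 3) = {[1]} \<union> {M (2 * n + 3)} \<union>
      {[1] @ p (2 * (n - i) + 2) @ [1] | i. i \<in> {0..n - 1}}"
    by (simp only: B_eq) blast
next
  show "B 3 = {[1], [1, 1]}"
    \<comment> \<open>No \<open>k\<close> has \<open>3 \<le> k\<close> and \<open>k < 3\<close>, and
      \<open>M 3\<close> is 11 because \<open>p 3\<close> is empty.\<close>
    by (auto simp: B_eq M_eq)
qed

end
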